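(* The best positive constants $p$ and $q$ in the inequality $$\frac{1}{(\cosh x)^p}<\frac{\sin x}{x}<\frac{1}{(\cosh x)^q}\qquad\text{for all } x\in\left(0,\frac{\pi}{2}\right)$$ are $p=\frac{\ln(\pi/2)}{\ln\cosh(\pi/2)}$ (approximately $0.49$) and $q=\frac13$. That is, $\frac{\ln(\pi/2)}{\ln\cosh(\pi/2)}$ is the least $p>0$ for which the left inequality holds for all $x\in(0,\frac{\pi}{2})$, and $\frac13$ is the greatest $q>0$ for which the right inequality holds for all $x\in(0,\frac{\pi}{2})$. *)

theory Defs
  imports Complex_Main
begin

end

theory Submission
  imports Defs "HOL-Real_Asymp.Real_Asymp"
begin

text \<open>
  Let \<open>F x = ln (x / sin x) - c * ln (cosh x)\<close>. Then \<open>F' x = tanh x * (K x - c)\<close>, where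
  \<open>K x = (1 / x - cot x) / tanh x\<close> is the product of the increasing functions
  \<open>(1 / x - cot x) / x\<close> and \<open>x / tanh x\<close>, whose limits at 0 are \<open>1/3\<close> and \<open>1\<close>. So \<open>K\<close> is
  increasing and exceeds \<open>1/3\<close>. For \<open>c = 1/3\<close> the function \<open>F\<close> is therefore increasing from
  \<open>0\<close>; for \<open>c = p\<^sub>0\<close> it vanishes at both ends of the interval and is first decreasing, then
  increasing, hence negative inside. Optimality follows by letting \<open>x\<close> tend to \<open>\<pi>/2\<close> and to \<open>0\<close>.
\<close>

section \<open>Trigonometric inequalities by repeated differentiation\<close>

lemma pos_if_deriv_pos:
  fixes f f' :: "real \<Rightarrow> real"
  assumes "f 0 = 0" "0 < x"
    and "\<And>y. (f has_real_derivative f' y) (at y)"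
    and "\<And>y. 0 < y \<Longrightarrow> y < x \<Longrightarrow> 0 < f' y"
  shows "0 < f x"
proof -
  have "continuous_on {0..x} f"
    using assms(3) by (intro DERIV_atLeastAtMost_imp_continuous_on) blast
  with DERIV_pos_imp_increasing_open[of 0 x f] assms show ?thesis by auto
qed

lemma sin_minus_x_cos_pos:
  assumes "0 < x" "x < pi"
  shows "0 < sin x - x * cos (x::real)"
proof (rule pos_if_deriv_pos[where f = "\<lambda>x. sin x - x * cos x" and f' = "\<lambda>y. y * sin y"])
  show "((\<lambda>x. sin x - x * cos x) has_real_derivative y * sin y) (at y)" for y
    by (auto intro!: derivative_eq_intros)
qed (use assms in \<open>auto simp: sin_gt_zero\<close>)

text \<open>Division by \<open>3 * x * sin x\<close> turns this into
  \<open>x / 3 < 1 / x - cot x\<close>, the source of the bound \<open>1 / 3 < K x\<close>.\<close>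

lemma sin_minus_x_cos_gt:
  assumes "0 < x" "x < pi"
  shows "x\<^sup>2 * sin x < 3 * (sin x - x * cos (x::real))"
proof -
  have "0 < 3 * (sin x - x * cos x) - x\<^sup>2 * sin x"
  proof (rule pos_if_deriv_pos[where f = "\<lambda>x. 3 * (sin x - x * cos x) - x\<^sup>2 * sin x"
        and f' = "\<lambda>y. y * (sin y - y * cos y)"])
    show "((\<lambda>x. 3 * (sin x - x * cos x) - x\<^sup>2 * sin x) has_real_derivative
        y * (sin y - y * cos y)) (at y)" for y
      by (auto intro!: derivative_eq_intros simp: algebra_simps power2_eq_square)
  qed (use assms sin_minus_x_cos_pos in auto)
  then show ?thesis by simp
qed

text \<open>Three differentiations lead to \<open>sin y - y * cos y\<close>, and every function in
  the chain vanishes at 0, so positivity passes back up step by step.\<close>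

lemma sin_cos_quadratic_pos:
  assumes "0 < y" "y < pi"
  shows "0 < y\<^sup>2 + y * sin y - 4 + 4 * cos (y::real)"
proof -
  have 2: "0 < 2 - 2 * cos y - y * sin y" if "0 < y" "y < pi" for y :: real
  proof (rule pos_if_deriv_pos[where f = "\<lambda>y. 2 - 2 * cos y - y * sin y"
        and f' = "\<lambda>y. sin y - y * cos y"])
    show "((\<lambda>y. 2 - 2 * cos y - y * sin y) has_real_derivative sin y - y * cos y) (at y)" for y
      by (auto intro!: derivative_eq_intros)
  qed (use that sin_minus_x_cos_pos in auto)
  have 1: "0 < 2 * y - 3 * sin y + y * cos y" if "0 < y" "y < pi" for y :: real
  proof (rule pos_if_deriv_pos[where f = "\<lambda>y. 2 * y - 3 * sin y + y * cos y"
        and f' = "\<lambda>y. 2 - 2 * cos y - y * sin y"])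
    show "((\<lambda>y. 2 * y - 3 * sin y + y * cos y) has_real_derivative
        2 - 2 * cos y - y * sin y) (at y)" for y
      by (auto intro!: derivative_eq_intros)
  qed (use that 2 in auto)
  show ?thesis
  proof (rule pos_if_deriv_pos[where f = "\<lambda>y. y\<^sup>2 + y * sin y - 4 + 4 * cos y"
        and f' = "\<lambda>y. 2 * y - 3 * sin y + y * cos y"])
    show "((\<lambda>y. y\<^sup>2 + y * sin y - 4 + 4 * cos y) has_real_derivative
        2 * y - 3 * sin y + y * cos y) (at y)" for y
      by (auto intro!: derivative_eq_intros)
  qed (use assms 1 in auto)
qed

lemma inverse_minus_cot_mono:
  assumes "0 < a" "a < b" "b < pi / 2"
  shows "(1 / a - cot a) / a < (1 / b - cot b) / (b::real)"
proof (rule DERIV_pos_imp_increasing[OF assms(2)])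
  fix x assume "a \<le> x" "x \<le> b"
  then have x: "0 < x" "x < pi / 2" using assms by auto
  have s: "0 < sin x" using x by (simp add: sin_gt_zero)
  \<comment> \<open>By the double-angle formulas this is four times the numerator of the derivative
    below; \<open>x < pi / 2\<close> keeps the doubled angle below \<open>pi\<close>.\<close>
  have "0 < (2 * x)\<^sup>2 + (2 * x) * sin (2 * x) - 4 + 4 * cos (2 * x)"
    using x by (intro sin_cos_quadratic_pos) auto
  then have N: "0 < x\<^sup>2 + x * sin x * cos x - 2 * (sin x)\<^sup>2"
    unfolding sin_double cos_double_sin by (simp add: algebra_simps power2_eq_square)
  have "((\<lambda>x. (1 / x - cot x) / x) has_real_derivative
      (x\<^sup>2 + x * sin x * cos x - 2 * (sin x)\<^sup>2) / (x ^ 3 * (sin x)\<^sup>2)) (at x)"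
    using x s
    by (auto intro!: derivative_eq_intros DERIV_cot[THEN DERIV_cong])
      (simp add: cot_def field_simps power2_eq_square power3_eq_cube)
  moreover have "0 < (x\<^sup>2 + x * sin x * cos x - 2 * (sin x)\<^sup>2) / (x ^ 3 * (sin x)\<^sup>2)"
    using N x s by simp
  ultimately show "\<exists>y. ((\<lambda>x. (1 / x - cot x) / x) has_real_derivative y) (at x) \<and> 0 < y"
    by blast
qed

section \<open>Hyperbolic inequalities\<close>

lemma less_sinh:
  assumes "0 < x"
  shows "x < sinh (x::real)"
proof -
  have "0 < sinh x - x"
    by (rule pos_if_deriv_pos[where f = "\<lambda>x. sinh x - x" and f' = "\<lambda>y. cosh y - 1"])
      (use assms cosh_real_strict_mono[of 0] in \<open>auto intro!: derivative_eq_intros\<close>)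
  then show ?thesis by simp
qed

text \<open>Written as \<open>x * cosh x / sinh x\<close>, the quotient has a derivative with
  numerator \<open>sinh x * cosh x - x\<close>, which is positive because \<open>sinh x > x\<close>
  and \<open>cosh x \<ge> 1\<close>.\<close>

lemma x_over_tanh_mono:
  assumes "0 < a" "a < b"
  shows "a / tanh a < b / tanh (b::real)"
proof (rule DERIV_pos_imp_increasing[OF assms(2)])
  fix x assume "a \<le> x" "x \<le> b"
  then have x: "0 < x" using assms by auto
  have s: "x < sinh x" by (rule less_sinh[OF x])
  have "sinh x * 1 \<le> sinh x * cosh x"
    using s x cosh_real_ge_1[of x] by (intro mult_left_mono) auto
  then have N: "0 < sinh x * cosh x - x" using s by simp
  have "((\<lambda>x. x * cosh x / sinh x) has_real_derivative (sinh x * cosh x - x) / (sinh x)\<^sup>2) (at x)"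
    using x s cosh_square_eq[of x]
    by (auto intro!: derivative_eq_intros simp: divide_simps) algebra
  then have "((\<lambda>x. x / tanh x) has_real_derivative (sinh x * cosh x - x) / (sinh x)\<^sup>2) (at x)"
    by (simp add: tanh_def)
  moreover have "0 < (sinh x * cosh x - x) / (sinh x)\<^sup>2"
    using N x by simp
  ultimately show "\<exists>y. ((\<lambda>x. x / tanh x) has_real_derivative y) (at x) \<and> 0 < y"
    by blast
qed

lemma tanh_less:
  assumes "0 < x"
  shows "tanh x < (x::real)"
proof -
  have "0 < x - tanh x"
    by (rule pos_if_deriv_pos[where f = "\<lambda>x. x - tanh x" and f' = "\<lambda>y. (tanh y)\<^sup>2"])
      (use assms in \<open>auto intro!: derivative_eq_intros\<close>)
  then show ?thesis by simp
qed

section \<open>Lower bound and monotonicity of \<open>K\<close>\<close>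

lemma inverse_minus_cot_gt:
  assumes "0 < x" "x < pi"
  shows "x / 3 < 1 / x - cot (x::real)"
  using sin_minus_x_cos_gt[OF assms] sin_gt_zero[OF assms] assms
  by (simp add: cot_def field_simps power2_eq_square)

lemma inverse_minus_cot_over_tanh_mono:
  assumes "0 < a" "a < b" "b < pi / 2"
  shows "(1 / a - cot a) / tanh a < (1 / b - cot b) / tanh (b::real)"
proof -
  have "(1 / a - cot a) / a * (a / tanh a) < (1 / b - cot b) / b * (b / tanh b)"
    \<comment> \<open>Multiplying the two strict inequalities requires positive factors;
      \<open>inverse_minus_cot_gt\<close> supplies this for the cotangent factor.\<close>
    using assms inverse_minus_cot_gt[of b] inverse_minus_cot_gt[of a]
    by (intro mult_strict_mono inverse_minus_cot_mono x_over_tanh_mono) auto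
  then show ?thesis using assms by simp
qed

section \<open>The function \<open>F\<close>, extended by its limit 0 at the origin\<close>

definition ln_defect :: "real \<Rightarrow> real \<Rightarrow> real" where
  "ln_defect c x = (if x = 0 then 0 else ln (x / sin x) - c * ln (cosh x))"

lemma ln_defect_deriv:
  assumes "0 < x" "x < pi"
  shows "(ln_defect c has_real_derivative 1 / x - cot x - c * tanh x) (at x)"
proof -
  have s: "0 < sin x" using assms by (simp add: sin_gt_zero)
  have "((\<lambda>x. ln (x / sin x) - c * ln (cosh x)) has_real_derivative
      1 / x - cot x - c * tanh x) (at x)"
    using assms s
    by (auto intro!: derivative_eq_intros simp: cot_def tanh_def field_simps)
  moreover have "eventually (\<lambda>y. ln_defect c y = ln (y / sin y) - c * ln (cosh y)) (nhds x)"
    using eventually_nhds_in_open[of "{0<..}" x] assms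
    by (auto elim!: eventually_mono simp: ln_defect_def)
  ultimately show ?thesis by (subst DERIV_cong_ev) auto
qed

lemma continuous_ln_defect:
  assumes "b < pi"
  shows "continuous_on {0..b} (ln_defect c)"
proof (rule continuous_at_imp_continuous_on, rule ballI)
  fix x assume x: "x \<in> {0..b}"
  show "isCont (ln_defect c) x"
  proof (cases "x = 0")
    case True
    have "((\<lambda>x. ln (x / sin x) - c * ln (cosh x)) \<longlongrightarrow> 0) (at 0)" by real_asymp
    moreover have "eventually (\<lambda>x. ln_defect c x = ln (x / sin x) - c * ln (cosh x)) (at 0)"
      by (auto simp: ln_defect_def eventually_at_filter)
    ultimately have "(ln_defect c \<longlongrightarrow> 0) (at 0)" by (simp add: filterlim_cong)
    then show ?thesis using True by (simp add: isCont_def ln_defect_def)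
  next
    case False
    with x assms have "0 < x" "x < pi" by auto
    from ln_defect_deriv[OF this] show ?thesis by (rule DERIV_isCont)
  qed
qed

text \<open>The continuous extension admits \<open>a = 0\<close>, and \<open>b = pi / 2\<close> lies
  inside the domain of differentiability, so both ends of the interval can be used.\<close>

lemma ln_defect_MVT:
  assumes "0 \<le> a" "a < b" "b < pi"
  obtains z where "a < z" "z < b"
    "ln_defect c b - ln_defect c a = (b - a) * (1 / z - cot z - c * tanh z)"
proof -
  have "continuous_on {a..b} (ln_defect c)"
    by (rule continuous_on_subset[OF continuous_ln_defect[OF assms(3)]]) (use assms in auto)
  moreover have "ln_defect c differentiable (at x)" if "a < x" "x < b" for x
    using ln_defect_deriv[of x c] that assms by (force simp: real_differentiable_def)
  ultimately obtain l z where z: "a < z" "z < b" "DERIV (ln_defect c) z :> l"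
    "ln_defect c b - ln_defect c a = (b - a) * l"
    using MVT[OF assms(2)] by metis
  moreover have "l = 1 / z - cot z - c * tanh z"
    using DERIV_unique[OF z(3) ln_defect_deriv[of z c]] z assms by auto
  ultimately show ?thesis using that by blast
qed

lemma ln_defect_third_pos:
  assumes "0 < x" "x < pi"
  shows "0 < ln_defect (1 / 3) x"
proof -
  obtain z where z: "0 < z" "z < x"
    "ln_defect (1 / 3) x - ln_defect (1 / 3) 0 = (x - 0) * (1 / z - cot z - 1 / 3 * tanh z)"
    using ln_defect_MVT[OF order_refl assms] by blast
  \<comment> \<open>The two bounds meet at \<open>z / 3\<close>:
    \<open>tanh z / 3 < z / 3 < 1 / z - cot z\<close>.\<close>
  have "0 < 1 / z - cot z - 1 / 3 * tanh z"
    using inverse_minus_cot_gt[of z] tanh_less[of z] z assms by auto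
  then show ?thesis using z assms by (simp add: ln_defect_def[of _ 0])
qed

text \<open>If the value at \<open>x\<close> were nonnegative, the mean value theorem on
  \<open>[0, x]\<close> would give \<open>y\<close> with \<open>c \<le> K y\<close>. Since
  \<open>K\<close> increases, the derivative at the mean value point \<open>z > x > y\<close> of
  \<open>[x, pi / 2]\<close> would be positive, yet the function does not increase from
  \<open>x\<close> to its zero at \<open>pi / 2\<close>.\<close>

lemma ln_defect_neg:
  assumes x: "0 < x" "x < pi / 2" and end0: "ln_defect c (pi / 2) = 0"
  shows "ln_defect c x < 0"
proof (rule ccontr)
  assume neg: "\<not> ?thesis"
  obtain y where y: "0 < y" "y < x"
    "ln_defect c x - ln_defect c 0 = (x - 0) * (1 / y - cot y - c * tanh y)"
    by (rule ln_defect_MVT[of 0 x c]) (use x in auto)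
  obtain z where z: "x < z" "z < pi / 2"
    "ln_defect c (pi / 2) - ln_defect c x = (pi / 2 - x) * (1 / z - cot z - c * tanh z)"
    by (rule ln_defect_MVT[of x "pi / 2" c]) (use x in auto)
  have "0 \<le> x * (1 / y - cot y - c * tanh y)"
    using y neg by (simp add: ln_defect_def[of _ 0])
  then have "0 \<le> 1 / y - cot y - c * tanh y"
    using x by (simp add: zero_le_mult_iff)
  then have "c \<le> (1 / y - cot y) / tanh y"
    using y by (simp add: pos_le_divide_eq)
  also have "\<dots> < (1 / z - cot z) / tanh z"
    using inverse_minus_cot_over_tanh_mono y z by auto
  finally have "0 < (pi / 2 - x) * (1 / z - cot z - c * tanh z)"
    using x z by (intro mult_pos_pos) (auto simp: pos_less_divide_eq)
  with z end0 neg show False by simp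
qed

section \<open>Reduction to the sign of \<open>ln_defect\<close>, and optimality of the
  exponents\<close>

lemma one_over_cosh_powr: "1 / cosh x powr r = exp (- (r * ln (cosh (x::real))))"
  by (simp add: powr_def exp_minus inverse_eq_divide)

lemma sin_over_x_eq_exp:
  assumes "0 < x" "x < pi"
  shows "sin x / x = exp (- ln (x / sin x))"
  using assms sin_gt_zero[OF assms] by (simp add: exp_minus)

lemma one_over_cosh_powr_less_iff:
  assumes "0 < x" "x < pi"
  shows "1 / cosh x powr r < sin x / x \<longleftrightarrow> ln_defect r x < 0"
    and "sin x / x < 1 / cosh x powr r \<longleftrightarrow> 0 < ln_defect r x"
  unfolding one_over_cosh_powr sin_over_x_eq_exp[OF assms] using assms
  by (auto simp: ln_defect_def)

text \<open>Positivity bounds \<open>q\<close> by \<open>ln (x / sin x) / ln (cosh x)\<close>. Near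
  0 the numerator behaves like \<open>x^2 / 6\<close> and the denominator like
  \<open>x^2 / 2\<close>.\<close>

lemma ln_defect_pos_imp_le_third:
  assumes "\<And>x. 0 < x \<Longrightarrow> x < pi / 2 \<Longrightarrow> 0 < ln_defect q x"
  shows "q \<le> 1 / 3"
proof (rule tendsto_lowerbound)
  show "((\<lambda>x. ln (x / sin x) / ln (cosh x)) \<longlongrightarrow> 1 / 3) (at_right (0::real))"
    by real_asymp
  have "eventually (\<lambda>x. x \<in> {0<..<pi / 2}) (at_right (0::real))"
    by (rule eventually_at_right_real) simp
  then show "eventually (\<lambda>x. q \<le> ln (x / sin x) / ln (cosh x)) (at_right (0::real))"
  proof eventually_elim
    case (elim x)
    then have "1 < cosh x" using cosh_real_strict_mono[of 0 x] by simp
    then have "0 < ln (cosh x)" by simp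
    with assms[of x] elim show ?case by (simp add: ln_defect_def field_simps)
  qed
qed simp

text \<open>By continuity the sign survives weakly at \<open>pi / 2\<close>, where
  \<open>sin\<close> is 1 and the inequality reads
  \<open>ln (pi / 2) \<le> p * ln (cosh (pi / 2))\<close>.\<close>

lemma ln_defect_neg_imp_ge:
  assumes "\<And>x. 0 < x \<Longrightarrow> x < pi / 2 \<Longrightarrow> ln_defect p x < 0"
  shows "ln (pi / 2) / ln (cosh (pi / 2)) \<le> p"
proof -
  have "ln_defect p (pi / 2) \<le> 0"
  proof (rule tendsto_upperbound)
    have "isCont (ln_defect p) (pi / 2)"
      by (rule DERIV_isCont[OF ln_defect_deriv]) auto
    then show "(ln_defect p \<longlongrightarrow> ln_defect p (pi / 2)) (at_left (pi / 2))"
      by (auto simp: isCont_def intro: filterlim_mono at_le)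
    have "eventually (\<lambda>x. x \<in> {0<..<pi / 2}) (at_left (pi / 2))"
      by (rule eventually_at_left_real) simp
    then show "eventually (\<lambda>x. ln_defect p x \<le> 0) (at_left (pi / 2))"
      by eventually_elim (use assms in force)
  qed simp
  moreover have "0 < ln (cosh (pi / 2))" using cosh_real_strict_mono[of 0 "pi / 2"] by simp
  ultimately show ?thesis by (simp add: ln_defect_def field_simps)
qed

section \<open>Numerical approximation of the left exponent\<close>

lemma pi_half_bounds: "1.57 < pi / 2" "pi / 2 < 1.575"
proof -
  \<comment> \<open>The signs of \<open>cos\<close> at 1.57 and 1.575 locate \<open>pi / 2\<close>.
    There the error is below 0.00003, while \<open>cos\<close> is about 0.0008 and -0.004.\<close>
  have taylor: "\<bar>cos x - (\<Sum>m<10. cos_coeff m * x ^ m)\<bar> \<le> x ^ 10 / fact 10" for x :: real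
  proof -
    obtain t where "cos x = (\<Sum>m<10. cos_coeff m * x ^ m) +
        cos (t + 1 / 2 * real 10 * pi) / fact 10 * x ^ 10"
      using Maclaurin_cos_expansion[of x 10] by auto
    then have "\<bar>cos x - (\<Sum>m<10. cos_coeff m * x ^ m)\<bar> =
        \<bar>cos (t + 1 / 2 * real 10 * pi)\<bar> * (x ^ 10 / fact 10)"
      by (simp add: abs_mult)
    also have "\<dots> \<le> 1 * (x ^ 10 / fact 10)"
      by (intro mult_right_mono abs_cos_le_one) simp
    finally show ?thesis by simp
  qed
  have "0 < cos (1.57 :: real)"
    using taylor[of "1.57", unfolded abs_le_iff]
    by (simp add: cos_coeff_def lessThan_nat_numeral fact_numeral field_simps)
  then show "1.57 < pi / 2"
    using cos_monotone_0_pi_le[of "pi / 2" "1.57"] pi_ge_two by (auto simp: not_less[symmetric])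
  have "cos (1.575 :: real) < 0"
    using taylor[of "1.575", unfolded abs_le_iff]
    by (simp add: cos_coeff_def lessThan_nat_numeral fact_numeral field_simps)
  then show "pi / 2 < 1.575"
    using cos_ge_zero[of "1.575"] by (auto simp: not_less[symmetric])
qed

lemma cosh_pi_half_bounds: "2.507 < cosh (pi / 2)" "cosh (pi / 2) < 2.53"
proof -
  \<comment> \<open>The even order 10 makes the remainder nonnegative for negative \<open>x\<close>
    as well.\<close>
  have lower: "(\<Sum>m<10. x ^ m / fact m) \<le> exp x" for x :: real
  proof -
    obtain t where "exp x = (\<Sum>m<10. x ^ m / fact m) + exp t / fact 10 * x ^ 10"
      using Maclaurin_exp_le[of x 10] by auto
    moreover have "0 \<le> exp t / fact 10 * x ^ 10" by simp
    ultimately show ?thesis by linarith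
  qed
  have "2.507 < cosh (1.57::real)"
    using lower[of "1.57"] lower[of "- 1.57"] unfolding cosh_def
    by (simp add: lessThan_nat_numeral fact_numeral field_simps)
  also have "\<dots> < cosh (pi / 2)"
    using pi_half_bounds by (intro cosh_real_strict_mono) auto
  finally show "2.507 < cosh (pi / 2)" .
  \<comment> \<open>Upper bounds for \<open>exp\<close> at 1.575 and -1.575 are obtained as
    reciprocals of lower bounds at the opposite points.\<close>
  have u: "0.2069 < exp (- 1.575 :: real)"
    using lower[of "- 1.575"] by (simp add: lessThan_nat_numeral fact_numeral field_simps)
  have "cosh (pi / 2) < cosh (1.575::real)"
    using pi_half_bounds by (intro cosh_real_strict_mono) auto
  also have "cosh (1.575::real) < 2.53"
  proof -
    have "exp (1.575::real) < 1 / 0.2069"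
      using u by (simp add: exp_minus field_simps)
    moreover have "exp (- 1.575::real) < 0.208"
    proof -
      have "1 / 0.208 < exp (1.575::real)"
        using lower[of "1.575"] by (simp add: lessThan_nat_numeral fact_numeral field_simps)
      then show ?thesis by (simp add: exp_minus field_simps)
    qed
    ultimately show ?thesis by (simp add: cosh_def)
  qed
  finally show "cosh (pi / 2) < 2.53" .
qed

text \<open>The exponent is enclosed between 17/35 > 0.485 and 45/91 < 0.495. Comparing integer
  powers of \<open>pi / 2\<close> and \<open>cosh (pi / 2)\<close> reduces both bounds to decimal
  arithmetic.\<close>

lemma exponent_approx: "\<bar>ln (pi / 2) / ln (cosh (pi / 2)) - 0.49\<bar> < 0.005"
proof -
  let ?C = "cosh (pi / 2)"
  have C: "0 < ln ?C" using cosh_pi_half_bounds by simp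
  have "?C ^ 17 < 2.53 ^ 17"
    using cosh_pi_half_bounds by (intro power_strict_mono) auto
  also have "\<dots> < 1.57 ^ 35" by (simp add: power_divide)
  also have "\<dots> < (pi / 2) ^ 35"
    using pi_half_bounds by (intro power_strict_mono) auto
  finally have "ln (?C ^ 17) < ln ((pi / 2) ^ 35)"
    by (subst ln_less_cancel_iff) auto
  then have 1: "17 * ln ?C < 35 * ln (pi / 2)" by (simp add: ln_realpow del: power_divide)
  have "(pi / 2) ^ 91 < 1.575 ^ 91"
    using pi_half_bounds by (intro power_strict_mono) auto
  also have "\<dots> < 2.507 ^ 45" by (simp add: power_divide)
  also have "\<dots> < ?C ^ 45"
    using cosh_pi_half_bounds by (intro power_strict_mono) auto
  finally have "ln ((pi / 2) ^ 91) < ln (?C ^ 45)"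
    by (subst ln_less_cancel_iff) auto
  then have 2: "91 * ln (pi / 2) < 45 * ln ?C" by (simp add: ln_realpow del: power_divide)
  have "0.485 < ln (pi / 2) / ln ?C" "ln (pi / 2) / ln ?C < 0.495"
    using 1 2 C by (simp_all add: pos_less_divide_eq pos_divide_less_eq)
  moreover have "\<bar>r - 0.49\<bar> < 0.005" if "0.485 < r" "r < 0.495" for r :: real
    using that by (simp add: abs_if)
  ultimately show ?thesis by blast
qed

theorem theorem2p1:
  shows "let p\<^sub>0 = ln (pi / 2) / ln (cosh (pi / 2)) :: real;
             q\<^sub>0 = 1 / 3 :: real
         in (p\<^sub>0 > 0 \<and>
             (\<forall>x\<in>{0<..<pi / 2}. 1 / (cosh x) powr p\<^sub>0 < sin x / x) \<and>
             (\<forall>p>0. (\<forall>x\<in>{0<..<pi / 2}. 1 / (cosh x) powr p < sin x / x) \<longrightarrow> p\<^sub>0 \<le> p)) \<and>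
            (q\<^sub>0 > 0 \<and>
             (\<forall>x\<in>{0<..<pi / 2}. sin x / x < 1 / (cosh x) powr q\<^sub>0) \<and>
             (\<forall>q>0. (\<forall>x\<in>{0<..<pi / 2}. sin x / x < 1 / (cosh x) powr q) \<longrightarrow> q \<le> q\<^sub>0)) \<and>
            \<bar>p\<^sub>0 - 0.49\<bar> < 0.005"
proof -
  define p :: real where "p = ln (pi / 2) / ln (cosh (pi / 2))"
  have "0 < ln (cosh (pi / 2))" using cosh_pi_half_bounds by simp
  \<comment> \<open>As \<open>sin (pi / 2) = 1\<close>, \<open>p\<close> is exactly the exponent for
    which the defect vanishes at the right end.\<close>
  then have "ln_defect p (pi / 2) = 0" by (simp add: ln_defect_def p_def)
  then have "1 / cosh x powr p < sin x / x" if "x \<in> {0<..<pi / 2}" for x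
    using that ln_defect_neg[of x p] by (subst one_over_cosh_powr_less_iff) auto
  moreover have "p \<le> r" if "\<forall>x\<in>{0<..<pi / 2}. 1 / cosh x powr r < sin x / x" for r
    unfolding p_def
    by (rule ln_defect_neg_imp_ge) (use that in \<open>auto simp flip: one_over_cosh_powr_less_iff\<close>)
  moreover have "sin x / x < 1 / cosh x powr (1 / 3)" if "x \<in> {0<..<pi / 2}" for x
    using that ln_defect_third_pos[of x] by (subst one_over_cosh_powr_less_iff) auto
  moreover have "q \<le> 1 / 3" if "\<forall>x\<in>{0<..<pi / 2}. sin x / x < 1 / cosh x powr q" for q
    by (rule ln_defect_pos_imp_le_third)
      (use that in \<open>auto simp flip: one_over_cosh_powr_less_iff\<close>)
  moreover have "\<bar>p - 0.49\<bar> < 0.005" using exponent_approx by (simp add: p_def)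
  \<comment> \<open>The approximation already forces \<open>p > 0.485\<close>.\<close>
  moreover from this have "0 < p" by (simp add: abs_if split: if_splits)
  ultimately show ?thesis unfolding Let_def p_def[symmetric] by simp
qed

end
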